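(* Let $\mathcal{H}:\mathbb{N}\to\mathbb{N}$ be a non-decreasing function with $\mathcal{H}(N)\to\infty$ as $N\to\infty$. Then: (1) There is a $2$-coloring of $\mathbb{N}$ such that for any two infinite sets $B,C\subseteq\mathbb{N}$ with $B+C$ monochromatic we have $$\max\{|B\cap[N]|,\,|C\cap[N]|\}<\mathcal{H}(N)$$ for infinitely many $N\in\mathbb{N}$. (2) There is a set $A\subseteq\mathbb{N}$ with $\underline{d}(A)=1$ such that for any two infinite sets $B,C\subseteq\mathbb{N}$ with $B+C\subseteq A$ we have $$\min\{|B\cap[N]|,\,|C\cap[N]|\}<\mathcal{H}(N)$$ for infinitely many $N\in\mathbb{N}$.
   Context: $\mathbb{N}=\{1,2,\ldots\}$ and $[N]=\{1,\ldots,N\}$. $B+C=\{b+c: b\in B,\ c\in C\}$. A $2$-coloring of $\mathbb{N}$ is a partition of $\mathbb{N}$ into two classes (colors), and a set is monochromatic if it is contained in one class. The lower natural density of $A\subseteq\mathbb{N}$ is $\underline{d}(A)=\liminf_{N\to\infty}\frac{|A\cap[N]|}{N}$. *)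

theory Defs
  imports
    Complex_Main
    "HOL-Library.Set_Algebras"
    "HOL-Library.Disjoint_Sets"
    "HOL-Library.FuncSet"
    "HOL-Library.Extended_Real"
    "HOL-Library.Liminf_Limsup"
begin

text \<open>
  The natural numbers start at 1: they are the set \<open>{1..}\<close> of type \<open>nat set\<close>, and \<open>[N]\<close> is
  \<open>{1..N}\<close>. The sumset \<open>B + C\<close> is the one of \<open>HOL-Library.Set_Algebras\<close>.
\<close>

text \<open>A coloring is the collection of its color classes. As in \<open>partition_on\<close>, both are nonempty.\<close>

definition two_coloring :: "nat set set \<Rightarrow> bool" where
  "two_coloring P \<longleftrightarrow> partition_on {1..} P \<and> card P = 2"

definition monochromatic :: "nat set set \<Rightarrow> nat set \<Rightarrow> bool" where
  "monochromatic P S \<longleftrightarrow> (\<exists>X\<in>P. S \<subseteq> X)"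

text \<open>The quotient at \<open>N = 0\<close> is \<open>0\<close> and does not affect the limit inferior.\<close>

definition lower_density :: "nat set \<Rightarrow> ereal" where
  "lower_density A = liminf (\<lambda>N. ereal (real (card (A \<inter> {1..N})) / real N))"

end

(* Fix very rapidly growing scales m_0 < m_1 < ..., so that a set with at least H(N) elements up to
   every large N has, in every late block [m_n, m_(n+1)), an element x with x + m_n < m_(n+1). Adding
   to x any number below m_n does not leave the block.

   For (1), colour the blocks alternately. One of B, C has such an x in each late block, and adding a
   fixed element of the other set gives sums of both colours.

   For (2), remove from block n a set of residues T_n modulo p. During stage k the modulus p = p_k is
   fixed, and T_n runs through all sets of at most p/(k+1) residues, repeated 2p+1 times. In one
   of the repetitions the sets R, S of residues mod p taken by B, C below m_n do not change. If
   S is small, then T = S + b with b in R meets every translate c + R, c in S. If S is large, a greedy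
   choice gives a T meeting every translate b + S. When T_n is this T, an element of B or of C in block
   n has a removed sum with an element of the other set below m_n. *)

theory Submission
  imports Defs
begin

section \<open>Rapidly growing scales and their blocks\<close>

text \<open>Each \<open>m (Suc n)\<close> is chosen recursively past a point from which
  \<open>H\<close> stays at least \<open>2 * m n + 2\<close>. The summand \<open>f n\<close>
  reserves a prescribed minimal length for block n, which part (2) uses to fit in the
  moduli.\<close>

lemma ex_scales:
  fixes H f :: "nat \<Rightarrow> nat"
  assumes "filterlim H at_top sequentially"
  shows "\<exists>m. strict_mono m \<and> m 0 = 0 \<and> (\<forall>n. m n + f n \<le> m (Suc n)) \<and>
           (\<forall>n. 2 * m n + 2 \<le> H (m (Suc n)))"
proof -
  have "\<forall>K. \<exists>N. \<forall>x\<ge>N. K \<le> H x"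
    using assms by (auto simp: filterlim_at_top eventually_sequentially)
  then obtain g where g: "\<And>K x. g K \<le> x \<Longrightarrow> K \<le> H x"
    by metis
  define m where "m = rec_nat 0 (\<lambda>n a. Suc (a + f n + g (2 * a + 2)))"
  have m: "m 0 = 0" "\<And>n. m (Suc n) = Suc (m n + f n + g (2 * m n + 2))"
    by (simp_all add: m_def)
  have "strict_mono m"
    by (simp add: strict_mono_Suc_iff m)
  moreover have "2 * m n + 2 \<le> H (m (Suc n))" for n
    by (rule g) (simp add: m)
  ultimately show ?thesis
    using m by (intro exI[of _ m]) auto
qed

lemma block_exists:
  fixes m :: "nat \<Rightarrow> nat"
  assumes "strict_mono m" "m 0 = 0"
  shows "\<exists>n. m n \<le> x \<and> x < m (Suc n)"
proof (induction x)
  case 0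
  show ?case
    using assms strict_monoD[of m 0 1] by (intro exI[of _ 0]) simp
next
  case (Suc x)
  then obtain n where n: "m n \<le> x" "x < m (Suc n)" by blast
  show ?case
  proof (cases "Suc x < m (Suc n)")
    case False
    then show ?thesis
      using n strict_monoD[OF assms(1), of "Suc n" "Suc (Suc n)"] by (intro exI[of _ "Suc n"]) simp
  qed (use n in \<open>auto intro!: exI[of _ n]\<close>)
qed

lemma block_unique:
  fixes m :: "nat \<Rightarrow> nat"
  assumes "strict_mono m" "m n \<le> x" "x < m (Suc n)" "m n' \<le> x" "x < m (Suc n')"
  shows "n = n'"
proof -
  have "m n < m (Suc n')" "m n' < m (Suc n)" using assms by linarith+
  then have "n < Suc n'" "n' < Suc n" using assms(1) by (simp_all add: strict_mono_less)
  then show ?thesis by simp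
qed

text \<open>The numbers up to \<open>d\<close> that are too close to an end lie in two intervals
  with at most \<open>a\<close> and \<open>a + 1\<close> elements, so \<open>2 * a + 2\<close>
  elements cannot all be bad. It is used with \<open>a = m n\<close> and
  \<open>d = m (Suc n)\<close>.\<close>

lemma block_element:
  assumes "2 * a + 2 \<le> card (B \<inter> {1..d})"
  shows "\<exists>x\<in>B. a \<le> x \<and> x + a < d"
proof (rule ccontr)
  assume "\<not> ?thesis"
  then have "B \<inter> {1..d} \<subseteq> {1..a} \<union> {d - a..d}" by force
  then have "card (B \<inter> {1..d}) \<le> card ({1..a} \<union> {d - a..d})"
    by (intro card_mono) auto
  also have "\<dots> \<le> card {1..a} + card {d - a..d}" by (rule card_Un_le)
  also have "\<dots> \<le> 2 * a + 1" by simp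
  finally show False using assms by simp
qed

section \<open>Small sets of residues that hit translates\<close>

text \<open>Greedy choice: some point always hits at least a \<open>1/k\<close> fraction of the remaining sets.\<close>

lemma greedy_hitting_set:
  fixes U :: "'a set" and I :: "'b set" and S :: "'b \<Rightarrow> 'a set"
  assumes "finite U" "U \<noteq> {}" "finite I"
    and S: "\<And>i. i \<in> I \<Longrightarrow> S i \<subseteq> U" "\<And>i. i \<in> I \<Longrightarrow> card U \<le> Suc k * card (S i)"
  shows "\<exists>T. T \<subseteq> U \<and> card T \<le> s \<and> card {i \<in> I. S i \<inter> T = {}} * Suc k ^ s \<le> card I * k ^ s"
proof (induction s)
  case 0
  show ?case by (rule exI[of _ "{}"]) simp
next
  case (Suc s)
  then obtain T where T: "T \<subseteq> U" "card T \<le> s"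
    "card {i \<in> I. S i \<inter> T = {}} * Suc k ^ s \<le> card I * k ^ s" by blast
  define J where "J = {i \<in> I. S i \<inter> T = {}}"
  define h where "h x = card {i \<in> J. x \<in> S i}" for x
  have "finite J" "J \<subseteq> I" using assms(3) by (auto simp: J_def)
  \<comment> \<open>Double counting of the incidences between points and the sets not yet hit;
    averaging over \<open>U\<close> then yields a point lying in at least a \<open>1 / Suc k\<close>
    fraction of these sets.\<close>
  have "(\<Sum>x\<in>U. h x) = (\<Sum>i\<in>J. card (S i))"
  proof -
    have "(\<Sum>x\<in>U. h x) = (\<Sum>x\<in>U. \<Sum>i\<in>J. if x \<in> S i then 1 else 0)"
      using \<open>finite J\<close> by (simp add: h_def sum.If_cases Int_def)
    also have "\<dots> = (\<Sum>i\<in>J. \<Sum>x\<in>U. if x \<in> S i then 1 else 0)" by (rule sum.swap)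
    also have "\<dots> = (\<Sum>i\<in>J. card (S i))"
    proof (rule sum.cong)
      fix i assume "i \<in> J"
      then have "{x \<in> U. x \<in> S i} = S i" using S(1) \<open>J \<subseteq> I\<close> by blast
      then show "(\<Sum>x\<in>U. if x \<in> S i then 1 else 0) = card (S i)"
        using assms(1) by (simp add: sum.If_cases Int_def)
    qed simp
    finally show ?thesis .
  qed
  then have "card J * card U \<le> Suc k * (\<Sum>x\<in>U. h x)"
    using sum_mono[of J "\<lambda>_. card U" "\<lambda>i. Suc k * card (S i)"] S(2) \<open>J \<subseteq> I\<close>
    by (auto simp: sum_distrib_left)
  have "\<exists>x\<in>U. card J \<le> Suc k * h x"
  proof (rule ccontr)
    assume "\<not> ?thesis"
    then have "(\<Sum>x\<in>U. Suc k * h x) < (\<Sum>x\<in>U. card J)"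
      using assms(1,2) by (intro sum_strict_mono) auto
    then show False
      using \<open>card J * card U \<le> _\<close> unfolding sum_distrib_left[symmetric] by (simp add: mult.commute)
  qed
  then obtain x where x: "x \<in> U" "card J \<le> Suc k * h x" by blast
  have "{i \<in> I. S i \<inter> insert x T = {}} = J - {i \<in> J. x \<in> S i}" by (auto simp: J_def)
  then have "card {i \<in> I. S i \<inter> insert x T = {}} = card J - h x"
    using \<open>finite J\<close> by (simp add: h_def card_Diff_subset)
  moreover have "(card J - h x) * Suc k \<le> card J * k"
    using x(2) by (simp add: diff_mult_distrib algebra_simps)
  ultimately have "card {i \<in> I. S i \<inter> insert x T = {}} * Suc k ^ Suc s \<le> card J * k * Suc k ^ s"
    by (metis (no_types, lifting) mult.assoc mult_le_mono1 power_Suc)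
  also have "\<dots> \<le> card I * k ^ Suc s"
    using mult_le_mono1[OF T(3), of k] by (simp add: J_def mult_ac)
  finally show ?case
    using x T(1,2) by (intro exI[of _ "insert x T"]) (auto simp: card_insert_if finite_subset[OF _ assms(1)])
qed

text \<open>The geometric decay of \<open>(k / Suc k) ^ s\<close> beats any linear factor. With
  \<open>p = Suc k * s\<close> the inequality says that \<open>s\<close> greedy choices leave fewer
  than one of \<open>p\<close> sets unhit.\<close>

lemma ex_linear_times_power_less:
  "\<exists>s>0. Suc k * s * k ^ s < Suc k ^ s"
proof -
  define x where "x = real k / real (Suc k)"
  have "norm x < 1" by (simp add: x_def)
  then have "(\<lambda>n. real (Suc k) * (real n * x ^ n)) \<longlonglongrightarrow> real (Suc k) * 0"
    by (intro tendsto_intros powser_times_n_limit_0)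
  then have "eventually (\<lambda>n. real (Suc k) * (real n * x ^ n) < 1) sequentially"
    by (rule order_tendstoD(2)) simp
  then have "eventually (\<lambda>n. real (Suc k) * (real n * x ^ n) < 1 \<and> n > 0) sequentially"
    by (intro eventually_conj eventually_gt_at_top)
  then obtain n where n: "real (Suc k) * (real n * x ^ n) < 1" "n > 0"
    using eventually_happens'[OF sequentially_bot] by blast
  then have "real (Suc k) * real n * real k ^ n < real (Suc k) ^ n"
    by (simp add: x_def power_divide field_simps del: of_nat_Suc)
  then have "real (Suc k * n * k ^ n) < real (Suc k ^ n)"
    by (simp only: of_nat_mult of_nat_power)
  then show ?thesis using n(2) by (auto simp only: of_nat_less_iff)
qed

text \<open>The roles are asymmetric: \<open>R\<close> stands for the possible residues of a new
  large element, \<open>S\<close> for the residues of elements of the other set already present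
  below the block.\<close>

definition hits :: "nat \<Rightarrow> nat set \<Rightarrow> nat set \<Rightarrow> nat set \<Rightarrow> bool" where
  "hits p T R S \<longleftrightarrow> (\<forall>b\<in>R. \<exists>c\<in>S. (b + c) mod p \<in> T)"

lemma mod_eq_imp_eq_nat:
  fixes x y p :: nat
  assumes "x < y + p" "y < x + p" "x mod p = y mod p"
  shows "x = y"
proof -
  have *: "u = v" if "u \<le> v" "v < u + p" "u mod p = v mod p" for u v
  proof -
    have "p dvd v - u" using that by (metis mod_eq_dvd_iff_nat)
    moreover have "v - u < p" using that by simp
    ultimately show ?thesis using that(1) by (auto dest: dvd_imp_le)
  qed
  show ?thesis using *[of x y] *[of y x] assms by fastforce
qed

lemma card_translate_mod:
  fixes p a :: nat
  assumes "S \<subseteq> {..<p}"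
  shows "card ((\<lambda>c. (a + c) mod p) ` S) = card S"
proof (rule card_image, rule inj_onI)
  fix x y assume "x \<in> S" "y \<in> S" and *: "(a + x) mod p = (a + y) mod p"
  then have "x < p" "y < p" using assms by auto
  then show "x = y"
    using mod_eq_imp_eq_nat[OF _ _ *] by simp
qed

text \<open>If \<open>S\<close> has at most \<open>s\<close> elements, the single translate
  \<open>b + S\<close> with \<open>b\<close> in \<open>R\<close> already works, in the direction
  \<open>hits p T S R\<close>. Otherwise each of the \<open>p\<close> translates of \<open>S\<close>
  has density above \<open>1 / Suc k\<close>, and the greedy choice gives
  \<open>hits p T R S\<close>.\<close>

lemma small_hitting_set:
  assumes p: "p = Suc k * s" and s: "0 < s" "p * k ^ s < Suc k ^ s"
    and R: "R \<subseteq> {..<p}" "R \<noteq> {}" and S: "S \<subseteq> {..<p}" "S \<noteq> {}"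
  shows "\<exists>T\<subseteq>{..<p}. card T \<le> s \<and> (hits p T R S \<or> hits p T S R)"
proof (cases "card S \<le> s")
  case True
  obtain b where "b \<in> R" using R by blast
  then have "hits p ((\<lambda>c. (b + c) mod p) ` S) S R"
    by (auto simp: hits_def add.commute intro!: bexI[of _ b])
  moreover have "p > 0" using p s by simp
  ultimately show ?thesis
    using card_translate_mod[of S p b] S True by (intro exI[of _ "(\<lambda>c. (b + c) mod p) ` S"]) auto
next
  case False
  have "p > 0" using p s by simp
  let ?S = "\<lambda>b. (\<lambda>c. (b + c) mod p) ` S"
  have "\<exists>T. T \<subseteq> {..<p} \<and> card T \<le> s \<and>
      card {i \<in> {..<p}. ?S i \<inter> T = {}} * Suc k ^ s \<le> card {..<p} * k ^ s"
  proof (rule greedy_hitting_set)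
    fix i
    have "Suc k * s \<le> Suc k * card S" using False by (intro mult_le_mono2) simp
    then show "card {..<p} \<le> Suc k * card (?S i)"
      unfolding card_translate_mod[OF S(1)] card_lessThan by (simp only: p)
  qed (use \<open>p > 0\<close> in auto)
  then obtain T where T: "T \<subseteq> {..<p}" "card T \<le> s"
    "card {i \<in> {..<p}. ?S i \<inter> T = {}} * Suc k ^ s \<le> p * k ^ s" by auto
  \<comment> \<open>A count of unhit translates that is less than 1 is 0.\<close>
  have "card {i \<in> {..<p}. ?S i \<inter> T = {}} * Suc k ^ s < 1 * Suc k ^ s"
    using le_less_trans[OF T(3) s(2)] by (simp only: mult_1)
  then have "card {i \<in> {..<p}. ?S i \<inter> T = {}} < 1" by (simp only: mult_less_cancel2)
  then have "card {i \<in> {..<p}. ?S i \<inter> T = {}} = 0" by simp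
  then have "{i \<in> {..<p}. ?S i \<inter> T = {}} = {}" by simp
  then have "hits p T R S" using R(1) by (fastforce simp: hits_def)
  then show ?thesis using T by blast
qed

text \<open>One finite list has to serve all pairs \<open>R\<close>, \<open>S\<close>, since the set
  \<open>A\<close> is built before \<open>B\<close> and \<open>C\<close> are known. The bound on
  \<open>card (e i)\<close> keeps the removed density at most \<open>1 / Suc k\<close>.\<close>

definition hitting_family :: "nat \<Rightarrow> nat \<Rightarrow> nat \<Rightarrow> (nat \<Rightarrow> nat set) \<Rightarrow> bool" where
  "hitting_family k p L e \<longleftrightarrow>
     0 < p \<and> 0 < L \<and> (\<forall>i<L. e i \<subseteq> {..<p} \<and> Suc k * card (e i) \<le> p) \<and>
     (\<forall>R S. R \<subseteq> {..<p} \<longrightarrow> R \<noteq> {} \<longrightarrow> S \<subseteq> {..<p} \<longrightarrow> S \<noteq> {} \<longrightarrow>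
       (\<exists>i<L. hits p (e i) R S \<or> hits p (e i) S R))"

text \<open>With \<open>p = Suc k * s\<close>, an enumeration of all sets of at most
  \<open>s\<close> residues qualifies.\<close>

lemma ex_hitting_family: "\<exists>p L e. hitting_family k p L e"
proof -
  obtain s where s: "s > 0" "Suc k * s * k ^ s < Suc k ^ s"
    using ex_linear_times_power_less by blast
  define p where "p = Suc k * s"
  define F where "F = {T. T \<subseteq> {..<p} \<and> card T \<le> s}"
  have "finite F" by (simp add: F_def)
  then obtain e where "bij_betw e {0..<card F} F" using ex_bij_betw_nat_finite by blast
  then have e: "e ` {..<card F} = F" by (simp add: bij_betw_def atLeast0LessThan)
  have "{} \<in> F" by (simp add: F_def)
  then have "0 < card F" using \<open>finite F\<close> by (auto simp: card_gt_0_iff)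
  moreover have "e i \<subseteq> {..<p} \<and> Suc k * card (e i) \<le> p" if "i < card F" for i
  proof -
    have "e i \<in> F" using e that by blast
    then show ?thesis unfolding F_def p_def by (auto simp del: mult_Suc)
  qed
  moreover have "\<exists>i<card F. hits p (e i) R S \<or> hits p (e i) S R"
    if RS: "R \<subseteq> {..<p}" "R \<noteq> {}" "S \<subseteq> {..<p}" "S \<noteq> {}" for R S
  proof -
    obtain T where "T \<in> F" and T: "hits p T R S \<or> hits p T S R"
      using small_hitting_set[OF p_def s(1) s(2)[folded p_def] RS] by (auto simp: F_def p_def)
    then obtain i where "i < card F" "e i = T" using e by (metis imageE lessThan_iff)
    then show ?thesis using T by (intro exI[of _ i]) simp
  qed
  moreover have "p > 0" using s by (simp add: p_def)
  ultimately have "hitting_family k p (card F) e" unfolding hitting_family_def by blast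
  then show ?thesis by blast
qed

section \<open>Density of a set given by residues in blocks\<close>

text \<open>Each full period contains at most \<open>card T\<close> such numbers; rounding the
  length up to a multiple of \<open>p\<close> adds at most \<open>p\<close>.\<close>

lemma card_residues_interval:
  fixes p a L :: nat
  assumes "0 < p" "T \<subseteq> {..<p}"
  shows "p * card {x \<in> {a..<a + L}. x mod p \<in> T} \<le> card T * (L + p)"
proof -
  have fT: "finite T" using assms finite_subset by blast
  have per: "card {x \<in> {a..<a + n * p}. x mod p \<in> T} \<le> n * card T" for n
  proof (induction n)
    case (Suc n)
    let ?X = "{x \<in> {a + n * p..<a + Suc n * p}. x mod p \<in> T}"
    have "inj_on (\<lambda>x. x mod p) ?X"
      by (rule inj_onI, rule mod_eq_imp_eq_nat) auto
    then have "card ?X \<le> card T"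
      using fT by (intro card_inj_on_le[of "\<lambda>x. x mod p"]) auto
    moreover have "{x \<in> {a..<a + Suc n * p}. x mod p \<in> T} \<subseteq> {x \<in> {a..<a + n * p}. x mod p \<in> T} \<union> ?X"
      by auto
    then have "card {x \<in> {a..<a + Suc n * p}. x mod p \<in> T} \<le> card {x \<in> {a..<a + n * p}. x mod p \<in> T} + card ?X"
      by (intro order.trans[OF card_mono card_Un_le]) auto
    ultimately show ?case using Suc.IH by simp
  qed simp
  define n where "n = Suc (L div p)"
  have "L mod p < p" using assms(1) by simp
  then have "L < n * p" "n * p \<le> L + p"
    using div_mult_mod_eq[of L p] unfolding n_def mult_Suc by linarith+
  then have "card {x \<in> {a..<a + L}. x mod p \<in> T} \<le> card {x \<in> {a..<a + n * p}. x mod p \<in> T}"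
    by (intro card_mono) auto
  also note per
  finally have "p * card {x \<in> {a..<a + L}. x mod p \<in> T} \<le> n * p * card T" by simp
  also have "\<dots> \<le> card T * (L + p)"
    using \<open>n * p \<le> L + p\<close> by (simp add: mult.commute)
  finally show ?thesis .
qed

lemma lower_density_eq_1I:
  fixes D :: "nat set"
  assumes "(\<lambda>N. real (card (D \<inter> {1..N})) / real N) \<longlonglongrightarrow> 0"
  shows "lower_density ({1..} - D) = 1"
proof -
  have "(\<lambda>N. 1 - real (card (D \<inter> {1..N})) / real N) \<longlonglongrightarrow> 1 - 0"
    by (intro tendsto_intros assms)
  moreover have "eventually (\<lambda>N. 1 - real (card (D \<inter> {1..N})) / real N =
      real (card (({1..} - D) \<inter> {1..N})) / real N) sequentially"
  \<comment> \<open>At \<open>N = 0\<close> the two sides are 1 and 0, because division by zero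
    gives 0.\<close>
  proof (rule eventually_sequentiallyI[of 1])
    fix N :: nat assume "1 \<le> N"
    have "({1..} - D) \<inter> {1..N} = {1..N} - D \<inter> {1..N}" by auto
    then have "card (({1..} - D) \<inter> {1..N}) = N - card (D \<inter> {1..N})"
      by (simp add: card_Diff_subset)
    moreover have "card (D \<inter> {1..N}) \<le> N"
      using card_mono[of "{1..N}" "D \<inter> {1..N}"] by simp
    ultimately show "1 - real (card (D \<inter> {1..N})) / real N = real (card (({1..} - D) \<inter> {1..N})) / real N"
      using \<open>1 \<le> N\<close> by (simp add: of_nat_diff field_simps)
  qed
  ultimately have "(\<lambda>N. real (card (({1..} - D) \<inter> {1..N})) / real N) \<longlonglongrightarrow> 1"
    by (simp add: tendsto_cong)
  then have "(\<lambda>N. ereal (real (card (({1..} - D) \<inter> {1..N})) / real N)) \<longlonglongrightarrow> ereal 1"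
    by (rule tendsto_ereal)
  then show ?thesis
    unfolding lower_density_def by (simp add: lim_imp_Liminf one_ereal_def)
qed

text \<open>In block n the set \<open>D\<close> has density at most
  \<open>1 / Suc (\<kappa> n)\<close>, up to an error \<open>q n\<close> from an incomplete period.
  The length of block n absorbs \<open>q n\<close> when the block is complete; for the last,
  incomplete block, the length of the preceding one does.\<close>

lemma density_zero_blocks:
  fixes m q \<kappa> :: "nat \<Rightarrow> nat"
  assumes m: "strict_mono m" "m 0 = 0" "\<And>n. m n + (q n + q (Suc n)) \<le> m (Suc n)"
    and T: "\<And>n. 0 < q n" "\<And>n. T n \<subseteq> {..<q n}" "\<And>n. Suc (\<kappa> n) * card (T n) \<le> q n"
    and \<kappa>: "filterlim \<kappa> at_top sequentially"
    and D: "D = {x. \<exists>n. m n \<le> x \<and> x < m (Suc n) \<and> x mod q n \<in> T n}"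
  shows "(\<lambda>N. real (card (D \<inter> {1..N})) / real N) \<longlonglongrightarrow> 0"
proof -
  have block: "Suc K * card (D \<inter> {m n..<x}) \<le> (x - m n) + q n"
    if "K \<le> \<kappa> n" "m n \<le> x" "x \<le> m (Suc n)" for K n x
  proof -
    have "D \<inter> {m n..<x} \<subseteq> {y \<in> {m n..<m n + (x - m n)}. y mod q n \<in> T n}"
    proof
      fix y assume y: "y \<in> D \<inter> {m n..<x}"
      then obtain n' where n': "m n' \<le> y" "y < m (Suc n')" "y mod q n' \<in> T n'" by (auto simp: D)
      then have "n' = n" using y that by (intro block_unique[OF m(1), of _ y]) auto
      then show "y \<in> {y \<in> {m n..<m n + (x - m n)}. y mod q n \<in> T n}"
        using y n' by auto
    qed
    then have "card (D \<inter> {m n..<x}) \<le> card {y \<in> {m n..<m n + (x - m n)}. y mod q n \<in> T n}"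
      by (intro card_mono) auto
    then have "q n * card (D \<inter> {m n..<x}) \<le> card (T n) * (x - m n + q n)"
      using card_residues_interval[OF T(1,2), of n "m n" "x - m n"] order.trans mult_le_mono2 by meson
    then have "Suc K * (q n * card (D \<inter> {m n..<x})) \<le> Suc K * card (T n) * (x - m n + q n)"
      unfolding mult.assoc by (rule mult_le_mono2)
    also have "\<dots> \<le> q n * (x - m n + q n)"
      using that(1) T(3)[of n] by (intro mult_le_mono1) (meson Suc_le_mono order.trans mult_le_mono1)
    finally have "q n * (Suc K * card (D \<inter> {m n..<x})) \<le> q n * (x - m n + q n)"
      by (simp only: mult.left_commute)
    then show ?thesis using T(1)[of n] by (simp only: mult_le_cancel1)
  qed
  have split: "card (D \<inter> {a..<c}) \<le> card (D \<inter> {a..<b}) + card (D \<inter> {b..<c})" for a b c :: nat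
    by (rule order.trans[OF card_mono card_Un_le]) auto
  have bound: "Suc K * card (D \<inter> {1..N}) \<le> Suc K * (m n0 + 1) + 3 * N"
    if K: "\<And>n. n \<ge> n0 \<Longrightarrow> K \<le> \<kappa> n" and "n0 \<ge> 1" "m n0 \<le> N" for K n0 N
  proof -
    have blocks: "Suc K * card (D \<inter> {m n0..<m n}) \<le> 2 * m n" if "n0 \<le> n" for n
      using that
    proof (induction n rule: dec_induct)
      case (step n)
      have "Suc K * card (D \<inter> {m n0..<m (Suc n)})
          \<le> Suc K * card (D \<inter> {m n0..<m n}) + Suc K * card (D \<inter> {m n..<m (Suc n)})"
        using split[of "m n0" "m (Suc n)" "m n"] by (metis add_mult_distrib2 mult_le_mono2)
      also have "\<dots> \<le> 2 * m n + (m (Suc n) - m n + q n)"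
        using step m(3)[of n] by (intro add_mono block K) auto
      also have "\<dots> \<le> 2 * m (Suc n)" using m(3)[of n] by linarith
      finally show ?case .
    qed simp
    obtain n where n: "m n \<le> N" "N < m (Suc n)" using block_exists[OF m(1,2)] by blast
    then have "m n0 < m (Suc n)" using that by linarith
    then have "n0 \<le> n" using m(1) by (simp add: strict_mono_less)
    \<comment> \<open>The predecessor \<open>n'\<close> exists because \<open>n0\<close> is
      positive; its block has length at least \<open>q n\<close>, whence \<open>q n \<le> N\<close>
      below.\<close>
    then obtain n' where n': "n = Suc n'" using \<open>n0 \<ge> 1\<close> by (cases n) auto
    have "card (D \<inter> {1..N}) \<le> card ({..<m n0} \<union> {N} \<union> D \<inter> {m n0..<N})"
      by (intro card_mono) auto
    also have "\<dots> \<le> (card {..<m n0} + card {N}) + card (D \<inter> {m n0..<N})"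
      by (intro order.trans[OF card_Un_le] add_mono card_Un_le order_refl)
    also have "\<dots> \<le> (m n0 + 1) + (card (D \<inter> {m n0..<m n}) + card (D \<inter> {m n..<N}))"
      using split[of "m n0" N "m n"] by simp
    finally have "Suc K * card (D \<inter> {1..N}) \<le> Suc K * (m n0 + 1) +
        (Suc K * card (D \<inter> {m n0..<m n}) + Suc K * card (D \<inter> {m n..<N}))"
      unfolding add_mult_distrib2[symmetric] by (rule mult_le_mono2)
    also have "\<dots> \<le> Suc K * (m n0 + 1) + (2 * m n + (N - m n + q n))"
      using n \<open>n0 \<le> n\<close> by (intro add_mono block blocks K order_refl) auto
    also have "\<dots> \<le> Suc K * (m n0 + 1) + 3 * N"
      using n m(3)[of n'] unfolding n' by (intro add_mono order_refl) linarith
    finally show ?thesis .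
  qed
  show ?thesis
  proof (rule LIMSEQ_I)
    fix r :: real assume "0 < r"
    \<comment> \<open>\<open>K\<close> makes the main term \<open>3 / Suc K\<close> smaller than
      \<open>r / 2\<close>; afterwards \<open>N1\<close> does the same for the contribution of the
      initial blocks.\<close>
    obtain K :: nat where "6 / r < real K" using reals_Archimedean2 by blast
    then have K: "3 / real (Suc K) < r / 2" using \<open>0 < r\<close> by (simp add: field_simps)
    have "eventually (\<lambda>n. K \<le> \<kappa> n) sequentially" using \<kappa> by (simp add: filterlim_at_top)
    then obtain n1 where "\<And>n. n \<ge> n1 \<Longrightarrow> K \<le> \<kappa> n" by (auto simp: eventually_sequentially)
    then have n0: "\<And>n. n \<ge> Suc n1 \<Longrightarrow> K \<le> \<kappa> n" by simp
    define M where "M = m (Suc n1)"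
    obtain N1 :: nat where "2 * real (M + 1) / r < real N1" using reals_Archimedean2 by blast
    have "norm (real (card (D \<inter> {1..N})) / real N - 0) < r" if "N \<ge> max (Suc M) N1" for N
    proof -
      have "N > 0" "real N1 \<le> real N" using that by simp_all
      then have *: "real (M + 1) / real N < r / 2"
        using less_le_trans[OF \<open>2 * real (M + 1) / r < real N1\<close> \<open>real N1 \<le> real N\<close>] \<open>0 < r\<close> \<open>N > 0\<close>
        by (simp add: field_simps)
      have "Suc K * card (D \<inter> {1..N}) \<le> Suc K * (M + 1) + 3 * N"
        using bound[OF n0, of "Suc n1" N] that by (simp add: M_def)
      then have "real (Suc K * card (D \<inter> {1..N})) \<le> real (Suc K * (M + 1) + 3 * N)"
        by (simp only: of_nat_le_iff)
      then have "real (Suc K) * real (card (D \<inter> {1..N})) \<le> real (Suc K) * real (M + 1) + 3 * real N"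
        by (simp only: of_nat_mult of_nat_add of_nat_numeral)
      then have "real (card (D \<inter> {1..N})) / real N \<le> real (M + 1) / real N + 3 / real (Suc K)"
        using \<open>N > 0\<close> by (simp add: divide_simps del: of_nat_Suc of_nat_add) (simp add: algebra_simps)
      then have "real (card (D \<inter> {1..N})) / real N < r" using * K by linarith
      then show ?thesis by simp
    qed
    then show "\<exists>n0. \<forall>n\<ge>n0. norm (real (card (D \<inter> {1..n})) / real n - 0) < r" by blast
  qed
qed

section \<open>Two pigeonhole facts\<close>

text \<open>Ensures that every set of a hitting family gets its turn within a single
  repetition.\<close>

lemma ex_mod_eq_window:
  fixes u L i :: nat
  assumes "i < L"
  shows "\<exists>n. u \<le> n \<and> n < u + L \<and> n mod L = i"
proof -
  have u: "u = u div L * L + u mod L" "u mod L < L" using assms by simp_all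
  show ?thesis
  proof (cases "u mod L \<le> i")
    case True
    have "(u div L * L + i) mod L = i" using assms by simp
    moreover have "u \<le> u div L * L + i" "u div L * L + i < u + L" using True u assms by linarith+
    ultimately show ?thesis by blast
  next
    case False
    have "(Suc (u div L) * L + i) mod L = i" using assms by (simp only: mod_mult_self3 mod_less)
    moreover have "u \<le> Suc (u div L) * L + i" "Suc (u div L) * L + i < u + L"
      using False u assms unfolding mult_Suc by linarith+
    ultimately show ?thesis by blast
  qed
qed

text \<open>Strict growth at each of the steps \<open>0, ..., M\<close> would force
  \<open>f (Suc M)\<close> above \<open>M\<close>.\<close>

lemma ex_constant_step:
  fixes f :: "nat \<Rightarrow> nat"
  assumes "\<And>j. f j \<le> f (Suc j)" "\<And>j. f j \<le> M"
  shows "\<exists>j\<le>M. f (Suc j) = f j"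
proof (rule ccontr)
  assume "\<not> ?thesis"
  then have "j \<le> Suc M \<Longrightarrow> j \<le> f j" for j
  proof (induction j)
    case (Suc j)
    then have "f (Suc j) \<noteq> f j" "j \<le> f j" by auto
    then show ?case using assms(1)[of j] by simp
  qed simp
  from this[of "Suc M"] show False using assms(2)[of "Suc M"] by simp
qed

section \<open>The coloring by alternating blocks\<close>

lemma ex_coloring_sparse_sumsets:
  fixes H :: "nat \<Rightarrow> nat"
  assumes "filterlim H at_top sequentially"
  shows "\<exists>P. two_coloring P \<and>
            (\<forall>B C. infinite B \<longrightarrow> infinite C \<longrightarrow> monochromatic P (B + C) \<longrightarrow>
               infinite {N \<in> {1..}. max (card (B \<inter> {1..N})) (card (C \<inter> {1..N})) < H N})"
proof -
  obtain m where m: "strict_mono m" "m 0 = 0" "\<And>n. 2 * m n + 2 \<le> H (m (Suc n))"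
    using ex_scales[OF assms, of "\<lambda>_. 0"] by blast
  have m_ge: "n \<le> m n" for n using m(1) by (rule strict_mono_imp_increasing)
  define X where "X i = {x \<in> {1..}. \<exists>n. n mod 2 = i \<and> m n \<le> x \<and> x < m (Suc n)}" for i :: nat
  have X: "x \<in> X (n mod 2)" if "m n \<le> x" "x < m (Suc n)" "1 \<le> x" for x n
    using that unfolding X_def by blast
  have disj: "X 0 \<inter> X 1 = {}"
  proof (rule ccontr)
    assume "X 0 \<inter> X 1 \<noteq> {}"
    then obtain x where "x \<in> X 0" "x \<in> X 1" by blast
    obtain n where "n mod 2 = 0" "m n \<le> x" "x < m (Suc n)"
      using \<open>x \<in> X 0\<close> unfolding X_def mem_Collect_eq by (elim conjE exE)
    moreover obtain n' where "n' mod 2 = 1" "m n' \<le> x" "x < m (Suc n')"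
      using \<open>x \<in> X 1\<close> unfolding X_def mem_Collect_eq by (elim conjE exE)
    ultimately show False using block_unique[OF m(1), of n x n'] by simp
  qed
  have un: "X 0 \<union> X 1 = {1..}"
  proof (intro equalityI subsetI)
    fix x :: nat assume "x \<in> {1..}"
    moreover obtain n where "m n \<le> x" "x < m (Suc n)" using block_exists[OF m(1,2)] by blast
    ultimately show "x \<in> X 0 \<union> X 1" 
      using X[of n x] mod_less_divisor[of 2 n] by (cases "n mod 2 = 0") auto
  qed (unfold X_def, blast)
  \<comment> \<open>Block 0 starts at 0, which is not coloured, so the starting points of blocks 2
    and 1 serve as witnesses.\<close>
  have ne: "X 0 \<noteq> {}" "X 1 \<noteq> {}"
  proof -
    have "m n \<in> X (n mod 2)" if "1 \<le> n" for n
      using that m_ge[of n] strict_monoD[OF m(1), of n "Suc n"] by (intro X) auto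
    from this[of 1] this[of 2] have "m 2 \<in> X 0" "m 1 \<in> X 1" by auto
    then show "X 0 \<noteq> {}" "X 1 \<noteq> {}" by auto
  qed
  have "X 0 \<noteq> X 1" using disj ne by blast
  then have "card {X 0, X 1} = 2" by (rule card_2_iff[THEN iffD2, OF exI, OF exI, OF conjI[OF refl]])
  moreover have "partition_on {1..} {X 0, X 1}"
    using disj un ne by (intro partition_onI) (auto simp: disjnt_def)
  ultimately have P: "two_coloring {X 0, X 1}" unfolding two_coloring_def by blast
  have "infinite {N \<in> {1..}. max (card (B \<inter> {1..N})) (card (C \<inter> {1..N})) < H N}" (is "infinite ?S")
    if inf: "infinite B" "infinite C" and mono: "monochromatic {X 0, X 1} (B + C)" for B C
  proof
    assume "finite ?S"
    then obtain N0 where "\<forall>N\<in>?S. N < N0" using finite_nat_set_iff_bounded by blast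
    then have N0: "H N \<le> max (card (B \<inter> {1..N})) (card (C \<inter> {1..N}))" if "N0 \<le> N" "1 \<le> N" for N
      using that by (force simp: not_less[symmetric])
    obtain b0 c0 where bc: "b0 \<in> B" "c0 \<in> C"
      using inf[THEN infinite_imp_nonempty] by blast
    \<comment> \<open>Since the maximum is at least \<open>H\<close>, one of the sets has an element
      well inside block n. The bound on \<open>n\<close> makes \<open>b0\<close> and
      \<open>c0\<close> smaller than \<open>m n\<close>, so adding the fixed element of the other
      set stays in the block.\<close>
    have sum: "\<exists>z\<in>B + C. z \<in> X (n mod 2)" if n: "N0 + b0 + c0 < n" for n
    proof -
      have small: "b0 < m n" "c0 < m n" "N0 \<le> m (Suc n)" "1 \<le> m (Suc n)" "1 \<le> m n"
        using n m_ge[of n] m_ge[of "Suc n"] by linarith+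
      have "2 * m n + 2 \<le> max (card (B \<inter> {1..m (Suc n)})) (card (C \<inter> {1..m (Suc n)}))"
        using m(3)[of n] N0[of "m (Suc n)"] small by linarith
      then consider "2 * m n + 2 \<le> card (B \<inter> {1..m (Suc n)})" | "2 * m n + 2 \<le> card (C \<inter> {1..m (Suc n)})"
        by (auto simp: le_max_iff_disj)
      then show ?thesis
      proof cases
        case 1
        then obtain x where "x \<in> B" "m n \<le> x" "x + m n < m (Suc n)" using block_element by blast
        then show ?thesis
          using bc small by (intro bexI[of _ "x + c0"] X) auto
      next
        case 2
        then obtain x where "x \<in> C" "m n \<le> x" "x + m n < m (Suc n)" using block_element by blast
        then show ?thesis
          using bc small by (intro bexI[of _ "b0 + x"] X) auto
      qed
    qed
    \<comment> \<open>Any late even index: blocks \<open>n\<close> and \<open>Suc n\<close> then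
      contain sums of opposite colours.\<close>
    define n where "n = 2 * Suc (N0 + b0 + c0)"
    have "n mod 2 = 0" "Suc n mod 2 = 1" by (simp_all add: n_def)
    then obtain z z' where "z \<in> B + C" "z \<in> X 0" "z' \<in> B + C" "z' \<in> X 1"
      using sum[of n] sum[of "Suc n"] by (force simp: n_def)
    then show False using mono disj by (auto simp: monochromatic_def)
  qed
  then show ?thesis using P by blast
qed

section \<open>The set of density one\<close>

lemma ex_dense_set_sparse_sumsets:
  fixes H :: "nat \<Rightarrow> nat"
  assumes "filterlim H at_top sequentially"
  shows "\<exists>A. A \<subseteq> {1..} \<and> lower_density A = 1 \<and>
            (\<forall>B C. infinite B \<longrightarrow> infinite C \<longrightarrow> B + C \<subseteq> A \<longrightarrow>
               infinite {N \<in> {1..}. min (card (B \<inter> {1..N})) (card (C \<inter> {1..N})) < H N})"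
proof -
  obtain p L e where family: "\<And>k. hitting_family k (p k) (L k) (e k)"
    using ex_hitting_family by metis
  then have pL: "\<And>k. 0 < p k" "\<And>k. 0 < L k" and
    e: "\<And>k i. i < L k \<Longrightarrow> e k i \<subseteq> {..<p k}" "\<And>k i. i < L k \<Longrightarrow> Suc k * card (e k i) \<le> p k"
    unfolding hitting_family_def by blast+
  have hit: "\<exists>i<L k. hits (p k) (e k i) R S \<or> hits (p k) (e k i) S R"
    if "R \<subseteq> {..<p k}" "R \<noteq> {}" "S \<subseteq> {..<p k}" "S \<noteq> {}" for k R S
    using family[of k] that unfolding hitting_family_def by blast
  \<comment> \<open>Stage k consists of the block indices from \<open>s k\<close> up to
    \<open>s (Suc k) - 1\<close>: \<open>2 * p k + 1\<close> repetitions of \<open>L k\<close>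
    blocks each. Below, \<open>\<kappa> n\<close> is the stage of block n.\<close>
  define s where "s = rec_nat 0 (\<lambda>k a. a + (2 * p k + 1) * L k)"
  have s: "s 0 = 0" "\<And>k. s (Suc k) = s k + (2 * p k + 1) * L k" by (simp_all add: s_def)
  have smono: "strict_mono s" using pL by (simp add: strict_mono_Suc_iff s)
  have s_ge: "k \<le> s k" for k using smono by (rule strict_mono_imp_increasing)
  obtain \<kappa> where \<kappa>: "\<And>n. s (\<kappa> n) \<le> n" "\<And>n. n < s (Suc (\<kappa> n))"
    using block_exists[OF smono s(1)] by metis
  have \<kappa>_ge: "k \<le> \<kappa> n" if "s k \<le> n" for k n
  proof -
    have "s k < s (Suc (\<kappa> n))" using that \<kappa>(2)[of n] by linarith
    then show ?thesis using smono by (simp add: strict_mono_less)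
  qed
  have \<kappa>_lim: "filterlim \<kappa> at_top sequentially"
    unfolding filterlim_at_top using \<kappa>_ge by (auto simp: eventually_sequentially)
  define q where "q n = p (\<kappa> n)" for n
  define T where "T n = e (\<kappa> n) (n mod L (\<kappa> n))" for n
  obtain m where m: "strict_mono m" "m 0 = 0" "\<And>n. m n + (q n + q (Suc n)) \<le> m (Suc n)"
    "\<And>n. 2 * m n + 2 \<le> H (m (Suc n))"
    using ex_scales[OF assms, of "\<lambda>n. q n + q (Suc n)"] by blast
  have m_ge: "n \<le> m n" for n using m(1) by (rule strict_mono_imp_increasing)
  \<comment> \<open>\<open>D\<close> collects the removed numbers, so that \<open>A\<close> is the
    complement of \<open>D\<close> in the positive integers.\<close>
  define D where "D = {x. \<exists>n. m n \<le> x \<and> x < m (Suc n) \<and> x mod q n \<in> T n}"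
  have "(\<lambda>N. real (card (D \<inter> {1..N})) / real N) \<longlonglongrightarrow> 0"
    by (rule density_zero_blocks[OF m(1-3) _ _ _ \<kappa>_lim D_def])
      (use pL e in \<open>auto simp: q_def T_def simp del: mult_Suc\<close>)
  then have "lower_density ({1..} - D) = 1" by (rule lower_density_eq_1I)
  moreover have "infinite {N \<in> {1..}. min (card (B \<inter> {1..N})) (card (C \<inter> {1..N})) < H N}" (is "infinite ?S")
    if inf: "infinite B" "infinite C" and sum: "B + C \<subseteq> {1..} - D" for B C
  proof
    assume "finite ?S"
    then obtain N0 where "\<forall>N\<in>?S. N < N0" using finite_nat_set_iff_bounded by blast
    then have N0: "H N \<le> min (card (B \<inter> {1..N})) (card (C \<inter> {1..N}))" if "N0 \<le> N" "1 \<le> N" for N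
      using that by (force simp: not_less[symmetric])
    obtain b0 c0 where bc: "b0 \<in> B" "c0 \<in> C"
      using inf[THEN infinite_imp_nonempty] by blast
    \<comment> \<open>A stage late enough that \<open>b0\<close> and \<open>c0\<close> lie below
      \<open>m n\<close> for all its indices n, which makes the residue sets nonempty, and that all
      these n exceed \<open>N0\<close>.\<close>
    define k where "k = Suc (N0 + b0 + c0)"
    define R where "R X n = (\<lambda>x. x mod p k) ` {x \<in> X. x < m n}" for X n
    have R_sub: "R X n \<subseteq> {..<p k}" for X n using pL(1) by (auto simp: R_def)
    then have R_fin: "finite (R X n)" for X n using finite_subset by blast
    have R_card: "card (R X n) \<le> p k" for X n using card_mono[OF _ R_sub[of X n]] by simp
    have R_mono: "R X n \<subseteq> R X n'" if "n \<le> n'" for X n n'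
    proof -
      have "m n \<le> m n'" using that m(1) by (simp add: strict_mono_less_eq)
      then show ?thesis by (force simp: R_def)
    qed
    \<comment> \<open>\<open>w j\<close> is the first index of repetition j within stage k.\<close>
    define w where "w j = s k + j * L k" for j
    have w_mono: "w j \<le> w (Suc j)" for j by (simp add: w_def)
    \<comment> \<open>The two residue sets only grow and have at most \<open>2 * p k\<close>
      elements together, so one of the \<open>2 * p k + 1\<close> repetitions adds no
      residue.\<close>
    have "\<exists>j\<le>2 * p k. card (R B (w (Suc j))) + card (R C (w (Suc j))) = card (R B (w j)) + card (R C (w j))"
    proof (rule ex_constant_step)
      show "card (R B (w j)) + card (R C (w j)) \<le> card (R B (w (Suc j))) + card (R C (w (Suc j)))" for j
        by (intro add_mono card_mono R_fin R_mono w_mono)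
      show "card (R B (w j)) + card (R C (w j)) \<le> 2 * p k" for j
        using R_card[of B "w j"] R_card[of C "w j"] by simp
    qed
    then obtain j where j: "j \<le> 2 * p k"
      "card (R B (w (Suc j))) + card (R C (w (Suc j))) = card (R B (w j)) + card (R C (w j))" by blast
    have le: "card (R X (w j)) \<le> card (R X (w (Suc j)))" for X
      by (intro card_mono R_fin R_mono w_mono)
    \<comment> \<open>Neither cardinality can drop, so equal sums force both to be equal, and then
      the nested residue sets coincide.\<close>
    have "card (R B (w j)) = card (R B (w (Suc j)))" "card (R C (w j)) = card (R C (w (Suc j)))"
      using j(2) le[of B] le[of C] by linarith+
    note const = this[THEN card_subset_eq[OF R_fin R_mono[OF w_mono]]]
    have "k \<le> m (w j)"
      using s_ge[of k] m_ge[of "w j"] by (simp add: w_def)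
    then have "b0 mod p k \<in> R B (w j)" "c0 mod p k \<in> R C (w j)"
      using bc by (auto simp: R_def k_def)
    then obtain i where i: "i < L k"
      "hits (p k) (e k i) (R B (w j)) (R C (w j)) \<or> hits (p k) (e k i) (R C (w j)) (R B (w j))"
      using hit[OF R_sub _ R_sub] by blast
    obtain n where n: "w j \<le> n" "n < w j + L k" "n mod L k = i"
      using ex_mod_eq_window[OF i(1)] by blast
    have n': "n < w (Suc j)" using n(2) by (simp add: w_def)
    have "Suc j * L k \<le> (2 * p k + 1) * L k" using j(1) by (intro mult_le_mono1) simp
    then have "n < s (Suc k)" "s k \<le> n" using n' n(1) unfolding w_def s by linarith+
    then have kn: "\<kappa> n = k" by (intro block_unique[OF smono \<kappa>]) auto
    have "Suc N0 \<le> n" using \<open>s k \<le> n\<close> s_ge[of k] by (simp add: k_def)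
    then have "2 * m n + 2 \<le> min (card (B \<inter> {1..m (Suc n)})) (card (C \<inter> {1..m (Suc n)}))"
      using m(4)[of n] N0[of "m (Suc n)"] m_ge[of "Suc n"] by linarith
    \<comment> \<open>Which direction of \<open>hits\<close> holds is not known in advance, so late
      elements of both sets are required; this is where the minimum enters.\<close>
    then obtain x y where x: "x \<in> B" "m n \<le> x" "x + m n < m (Suc n)"
      and y: "y \<in> C" "m n \<le> y" "y + m n < m (Suc n)"
      using block_element[of "m n" B "m (Suc n)"] block_element[of "m n" C "m (Suc n)"]
      unfolding min.bounded_iff by blast
    have D_sum: "\<exists>v\<in>Y. u + v \<in> D"
      if h: "hits (p k) (e k i) (R X (w j)) (R Y (w j))" and "R X (w j) = R X (w (Suc j))"
        "u \<in> X" "m n \<le> u" "u + m n < m (Suc n)" for X Y u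
    proof -
      \<comment> \<open>Constancy over the repetition is used here: the new element \<open>u\<close>
        lies below \<open>m (Suc n)\<close>, hence its residue was already present at
        \<open>w j\<close>.\<close>
      have "u mod p k \<in> R X (Suc n)" using that by (auto simp: R_def)
      then have "u mod p k \<in> R X (w j)" using R_mono[of "Suc n" "w (Suc j)" X] n' that(2) by auto
      then obtain r where r: "r \<in> R Y (w j)" "(u mod p k + r) mod p k \<in> e k i"
        using h by (auto simp: hits_def)
      \<comment> \<open>The residue \<open>r\<close> is realised by some \<open>v\<close> below
        \<open>m n\<close>, so \<open>u + v\<close> remains in block n and has a removed
        residue.\<close>
      then have "r \<in> R Y n" using R_mono[OF n(1)] by blast
      then obtain v where v: "v \<in> Y" "v < m n" "r = v mod p k" by (auto simp: R_def)
      then have "(u + v) mod q n \<in> T n"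
        using r(2) by (simp add: q_def T_def kn n(3) mod_add_eq)
      then have "u + v \<in> D" using v that(4,5) by (auto simp: D_def intro!: exI[of _ n])
      then show ?thesis using v by blast
    qed
    show False
    proof (rule disjE[OF i(2)])
      assume "hits (p k) (e k i) (R B (w j)) (R C (w j))"
      then obtain v where "v \<in> C" "x + v \<in> D" using D_sum const x by blast
      then show False using sum x(1) by auto
    next
      assume "hits (p k) (e k i) (R C (w j)) (R B (w j))"
      then obtain v where "v \<in> B" "v + y \<in> D" using D_sum[of C B y] const y by (auto simp: add.commute)
      then show False using sum y(1) by auto
    qed
  qed
  ultimately show ?thesis by (intro exI[of _ "{1..} - D"]) auto
qed

theorem theorem1:
  fixes H :: "nat \<Rightarrow> nat"
  assumes "H \<in> {1..} \<rightarrow> {1..}"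
    and "mono_on {1..} H"
    and "filterlim H at_top sequentially"
  shows "(\<exists>P. two_coloring P \<and>
            (\<forall>B C. B \<subseteq> {1..} \<longrightarrow> C \<subseteq> {1..} \<longrightarrow> infinite B \<longrightarrow> infinite C \<longrightarrow>
               monochromatic P (B + C) \<longrightarrow>
               infinite {N \<in> {1..}. max (card (B \<inter> {1..N})) (card (C \<inter> {1..N})) < H N}))
       \<and> (\<exists>A. A \<subseteq> {1..} \<and> lower_density A = 1 \<and>
            (\<forall>B C. B \<subseteq> {1..} \<longrightarrow> C \<subseteq> {1..} \<longrightarrow> infinite B \<longrightarrow> infinite C \<longrightarrow>
               B + C \<subseteq> A \<longrightarrow>
               infinite {N \<in> {1..}. min (card (B \<inter> {1..N})) (card (C \<inter> {1..N})) < H N}))"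
proof (rule conjI, goal_cases)
  case 1
  obtain P where "two_coloring P" and P: "\<forall>B C. infinite B \<longrightarrow> infinite C \<longrightarrow> monochromatic P (B + C) \<longrightarrow>
      infinite {N \<in> {1..}. max (card (B \<inter> {1..N})) (card (C \<inter> {1..N})) < H N}"
    using ex_coloring_sparse_sumsets[OF assms(3)] by (elim exE conjE)
  show ?case
    by (intro exI[of _ P] conjI allI impI) (fact, rule P[rule_format])
next
  case 2
  obtain A where "A \<subseteq> {1..}" "lower_density A = 1" and
    A: "\<forall>B C. infinite B \<longrightarrow> infinite C \<longrightarrow> B + C \<subseteq> A \<longrightarrow>
      infinite {N \<in> {1..}. min (card (B \<inter> {1..N})) (card (C \<inter> {1..N})) < H N}"
    using ex_dense_set_sparse_sumsets[OF assms(3)] by (elim exE conjE)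
  show ?case
    by (intro exI[of _ A] conjI allI impI) (fact, fact, rule A[rule_format])
qed

end
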